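(* Let $f:\mathbb{N}\to\mathbb{C}$ be a nonzero multiplicative function. Then $f$ is Toeplitz if and only if there are a Dirichlet character $\chi$ and a finite set $F$ of prime numbers such that $f(n)=\chi(n)$ for all $n\in\mathbb{N}$ coprime with all numbers in $F$. Moreover, each multiplicative Toeplitz sequence is regular.
   Context: $\mathbb{N}=\{1,2,\ldots\}$. A function $f:\mathbb{N}\to\mathbb{C}$ is multiplicative if $f(mn)=f(m)f(n)$ for all coprime $m,n$ (no boundedness is assumed). For $m\ge 1$ put $Per_m(f)=\{n\in\mathbb{N}: f(n)=f(n')\text{ for all }n'\in\mathbb{N}\text{ with }n'\equiv n \bmod m\}$. The sequence $f$ is Toeplitz if $\mathbb{N}=\bigcup_{m\ge1}Per_m(f)$. The $m$-skeleton of $f$ is the $m$-periodic sequence obtained from $f$ by replacing the values at positions in $\mathbb{N}\setminus Per_m(f)$ by a new symbol (a "hole"); $m$ is an essential period of $f$ if $m$ is the smallest period of the $m$-skeleton. A period structure of a Toeplitz sequence $f$ is a sequence $m_1|m_2|\ldots$ of essential periods of $f$ with $\mathbb{N}=\bigcup_k Per_{m_k}(f)$; it always exists. A Toeplitz sequence $f$ is regular if for a period structure $(m_k)$ the proportion $\frac{1}{m_k}|\{1\le j\le m_k: j\in Per_{m_k}(f)\}|$ tends to $1$ as $k\to\infty$ (equivalently, the natural density of $\mathbb{N}\setminus Per_{m_k}(f)$ tends to $0$). *)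

theory Defs
  imports Complex_Main "HOL-Number_Theory.Cong"
begin

text \<open>
  Sequences indexed by the positive integers are functions on \<^typ>\<open>nat\<close> whose value at 0
  is never inspected.
\<close>

definition multiplicative_fun :: "(nat \<Rightarrow> complex) \<Rightarrow> bool" where
  "multiplicative_fun f \<longleftrightarrow>
     (\<forall>m n. m \<ge> 1 \<and> n \<ge> 1 \<and> coprime m n \<longrightarrow> f (m * n) = f m * f n)"

definition Per :: "nat \<Rightarrow> (nat \<Rightarrow> 'a) \<Rightarrow> nat set" where
  "Per m f = {n. n \<ge> 1 \<and> (\<forall>n'. n' \<ge> 1 \<and> [n' = n] (mod m) \<longrightarrow> f n = f n')}"

definition toeplitz :: "(nat \<Rightarrow> 'a) \<Rightarrow> bool" where
  "toeplitz f \<longleftrightarrow> {n. n \<ge> 1} = (\<Union>m\<in>{m. m \<ge> 1}. Per m f)"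

text \<open>The hole symbol is \<^const>\<open>None\<close>.\<close>

definition skeleton :: "nat \<Rightarrow> (nat \<Rightarrow> 'a) \<Rightarrow> nat \<Rightarrow> 'a option" where
  "skeleton m f n = (if n \<in> Per m f then Some (f n) else None)"

definition is_period :: "(nat \<Rightarrow> 'a) \<Rightarrow> nat \<Rightarrow> bool" where
  "is_period s p \<longleftrightarrow> p \<ge> 1 \<and> (\<forall>n\<ge>1. s (n + p) = s n)"

definition essential_period :: "(nat \<Rightarrow> 'a) \<Rightarrow> nat \<Rightarrow> bool" where
  "essential_period f m \<longleftrightarrow>
     is_period (skeleton m f) m \<and> (\<forall>p. is_period (skeleton m f) p \<longrightarrow> m \<le> p)"

text \<open>
  Consecutive members of a period structure may coincide; otherwise periodic sequences, which
  have only finitely many essential periods, would not have one.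
\<close>

definition period_structure :: "(nat \<Rightarrow> 'a) \<Rightarrow> (nat \<Rightarrow> nat) \<Rightarrow> bool" where
  "period_structure f m \<longleftrightarrow>
     (\<forall>k. essential_period f (m k)) \<and> (\<forall>k. m k dvd m (Suc k)) \<and>
     {n. n \<ge> 1} = (\<Union>k. Per (m k) f)"

definition regular_toeplitz :: "(nat \<Rightarrow> 'a) \<Rightarrow> bool" where
  "regular_toeplitz f \<longleftrightarrow> toeplitz f \<and>
     (\<exists>m. period_structure f m \<and>
        (\<lambda>k. real (card {j \<in> {1..m k}. j \<in> Per (m k) f}) / real (m k)) \<longlonglongrightarrow> 1)"

text \<open>
  Dirichlet characters modulo \<open>q\<close>, restricted to the natural numbers (which determines them,
  by periodicity). The value 1 at 1 follows from the last two conditions.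
\<close>

definition dirichlet_character :: "nat \<Rightarrow> (nat \<Rightarrow> complex) \<Rightarrow> bool" where
  "dirichlet_character q \<chi> \<longleftrightarrow> q \<ge> 1 \<and>
     (\<forall>n. \<chi> (n + q) = \<chi> n) \<and>
     (\<forall>a b. \<chi> (a * b) = \<chi> a * \<chi> b) \<and>
     (\<forall>n. \<chi> n \<noteq> 0 \<longleftrightarrow> coprime n q)"

end

theory Submission
  imports Defs
begin

text \<open>
  If \<open>f \<noteq> 0\<close> is Toeplitz, then \<open>f = f 1 = 1\<close> on some class \<open>1 + m\<nat>\<close>. Multiplying a residue prime to \<open>m\<close> by
  an inverse modulo \<open>m\<close> that is coprime to all the numbers involved shows that \<open>f\<close> is
  \<open>m\<close>-periodic and completely multiplicative on the integers prime to \<open>m\<close>.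

  Conversely, let \<open>f\<close> agree with a character modulo \<open>q\<close> off the primes in \<open>F\<close>, and let \<open>P\<close> be
  the product of \<open>F\<close>. If no \<open>p ^ e\<close> with \<open>p \<in> F\<close> divides \<open>n\<close>, then the part of \<open>n\<close> composed of
  the primes in \<open>F\<close> is \<open>gcd n (P ^ e)\<close>, and it depends only on \<open>n\<close> modulo \<open>P ^ e\<close>; hence
  \<open>n \<in> Per (q * P ^ e) f\<close>. The exceptional \<open>n\<close> have density at most
  \<open>card F / 2 ^ e\<close>, which gives regularity along the least periods of the skeletons for
  the moduli \<open>fact k\<close>.
\<close>

section \<open>Periods and skeletons\<close>

lemma is_period_add_mult:
  assumes "is_period s p" "n \<ge> 1"
  shows "s (n + k * p) = s n"
proof (induction k)
  case (Suc k)
  have "s (n + k * p + p) = s (n + k * p)"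
    using assms unfolding is_period_def by simp
  then show ?case using Suc by (simp add: algebra_simps)
qed simp

lemma is_period_cong:
  assumes s: "is_period s p" and "a \<ge> 1" "b \<ge> 1" "[a = b] (mod p)"
  shows "s a = s b"
proof -
  have *: "s a = s b" if "a \<le> b" "a \<ge> 1" "[a = b] (mod p)" for a b
  proof -
    obtain k where "b = a + k * p"
      using \<open>a \<le> b\<close> \<open>[a = b] (mod p)\<close>
      by (metis cong_le_nat cong_sym add.commute)
    then show ?thesis using is_period_add_mult[OF s \<open>a \<ge> 1\<close>] by simp
  qed
  show ?thesis
    using *[of a b] *[of b a] assms cong_sym by (metis nat_le_linear)
qed

text \<open>The remainder \<open>p' mod p\<close> would otherwise be a smaller positive period,
  since shifting by it and by \<open>p'\<close> differ by a multiple of \<open>p\<close>.\<close>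

lemma least_period_dvd:
  assumes p: "is_period s p" and least: "\<And>p'. is_period s p' \<Longrightarrow> p \<le> p'"
    and p': "is_period s p'"
  shows "p dvd p'"
proof (rule ccontr)
  assume "\<not> p dvd p'"
  then have pos: "p' mod p \<ge> 1" by (simp add: dvd_eq_mod_eq_0 Suc_le_eq)
  have "s (n + p' mod p) = s n" if "n \<ge> 1" for n
  proof -
    have "s (n + p' mod p) = s (n + p')"
      by (rule is_period_cong[OF p]) (use that in \<open>auto simp: cong_def mod_add_right_eq\<close>)
    then show ?thesis using p' that unfolding is_period_def by simp
  qed
  then have "is_period s (p' mod p)" using pos unfolding is_period_def by simp
  then have "p \<le> p' mod p" by (rule least)
  moreover have "p' mod p < p" using p unfolding is_period_def by simp
  ultimately show False by simp
qed

section \<open>Periodic positions versus periods of the skeleton\<close>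

lemma Per_cong:
  assumes "a \<in> Per m f" "b \<ge> 1" "[b = a] (mod m)"
  shows "b \<in> Per m f" "f b = f a"
proof -
  have *: "f a = f c" if "c \<ge> 1" "[c = a] (mod m)" for c
    using assms(1) that unfolding Per_def by blast
  show fb: "f b = f a" using *[of b] assms by simp
  have "f b = f c" if "c \<ge> 1" "[c = b] (mod m)" for c
    unfolding fb using that(1) cong_trans[OF that(2) assms(3)] by (rule *)
  then show "b \<in> Per m f" unfolding Per_def using assms(2) by blast
qed

lemma Per_mono: "m dvd m' \<Longrightarrow> Per m f \<subseteq> Per m' f"
  unfolding Per_def by (auto dest: cong_dvd_modulus_nat)

lemma is_period_skeleton:
  assumes "m \<ge> 1"
  shows "is_period (skeleton m f) m"
proof -
  have "n + m \<in> Per m f \<longleftrightarrow> n \<in> Per m f" if "n \<ge> 1" for n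
    using Per_cong(1)[of n m f "n + m"] Per_cong(1)[of "n + m" m f n] that
    by (auto simp: cong_def)
  moreover have "f (n + m) = f n" if "n \<in> Per m f" "n \<ge> 1" for n
    using Per_cong(2)[of n m f "n + m"] that by (auto simp: cong_def)
  ultimately show ?thesis using assms unfolding is_period_def skeleton_def by auto
qed

lemma Per_subset_if_is_period_skeleton:
  assumes "is_period (skeleton m f) p"
  shows "Per m f \<subseteq> Per p f"
proof
  fix n assume n: "n \<in> Per m f"
  then have "n \<ge> 1" unfolding Per_def by simp
  moreover have "f n = f n'" if "n' \<ge> 1" "[n' = n] (mod p)" for n'
  proof -
    have "skeleton m f n' = skeleton m f n"
      using is_period_cong[OF assms that(1) \<open>n \<ge> 1\<close> that(2)] .
    then show ?thesis using n unfolding skeleton_def by (auto split: if_splits)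
  qed
  ultimately show "n \<in> Per p f" unfolding Per_def by blast
qed

text \<open>Together with the preceding lemma this characterizes the periods of the
  \<open>m\<close>-skeleton as the \<open>p\<close> with \<open>Per m f \<subseteq> Per p f\<close>.
  Shifting by \<open>p\<close> keeps \<open>Per m f\<close> invariant, and \<open>m\<close> such
  shifts return to the same class modulo \<open>m\<close>.\<close>

lemma is_period_skeleton_if_Per_subset:
  assumes sub: "Per m f \<subseteq> Per p f" and "m \<ge> 1" "p \<ge> 1"
  shows "is_period (skeleton m f) p"
proof -
  have step: "n + p \<in> Per m f \<and> f (n + p) = f n" if n: "n \<in> Per m f" for n
  proof -
    have "f n' = f n" if n': "n' \<ge> 1" "[n' = n + p] (mod m)" for n'
    proof -
      \<comment> \<open>Modulo \<open>m\<close>, adding \<open>(m - 1) * p\<close> amounts to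
        subtracting \<open>p\<close>, so \<open>n'\<close> is moved into the class of
        \<open>n\<close> while its class modulo \<open>p\<close> is kept.\<close>
      have "[n' + (m - 1) * p = n + p + (m - 1) * p] (mod m)"
        using n'(2) by (rule cong_add) simp
      also have "n + p + (m - 1) * p = n + m * p"
        using \<open>m \<ge> 1\<close> by (cases m) auto
      also have "[n + m * p = n] (mod m)" by (simp add: cong_def)
      finally have c: "[n' + (m - 1) * p = n] (mod m)" .
      have "n' + (m - 1) * p \<in> Per m f" "f (n' + (m - 1) * p) = f n"
        using Per_cong[OF n _ c] n' by auto
      then show ?thesis
        using Per_cong(2)[of "n' + (m - 1) * p" p f n'] sub n' by (auto simp: cong_def)
    qed
    note * = this
    have "f (n + p) = f n" using *[of "n + p"] \<open>p \<ge> 1\<close> by simp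
    then show ?thesis using * \<open>p \<ge> 1\<close> unfolding Per_def by auto
  qed
  have unstep: "n \<in> Per m f" if n: "n + p \<in> Per m f" "n \<ge> 1" for n
  proof -
    \<comment> \<open>The way back also runs forward: further shifts lead to
      \<open>n + m * p\<close>, which lies in the class of \<open>n\<close> modulo
      \<open>m\<close>.\<close>
    have "n + p + k * p \<in> Per m f" for k
    proof (induction k)
      case (Suc k)
      then show ?case using step[of "n + p + k * p"] by (simp add: algebra_simps)
    qed (use n in simp)
    from this[of "m - 1"] have "n + m * p \<in> Per m f"
      using \<open>m \<ge> 1\<close> by (cases m) (auto simp: algebra_simps)
    then show ?thesis by (rule Per_cong(1)) (use n in \<open>auto simp: cong_def\<close>)
  qed
  have "skeleton m f (n + p) = skeleton m f n" if "n \<ge> 1" for n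
    unfolding skeleton_def using step[of n] unstep[of n] that by (cases "n \<in> Per m f") auto
  then show ?thesis unfolding is_period_def using \<open>p \<ge> 1\<close> by blast
qed

section \<open>Essential periods and the existence of a period structure\<close>

definition least_period :: "(nat \<Rightarrow> 'a) \<Rightarrow> nat" where
  "least_period s = (LEAST p. is_period s p)"

context
  fixes m :: nat and f :: "nat \<Rightarrow> 'a"
  assumes m: "m \<ge> 1"
begin

lemma is_period_least_period: "is_period (skeleton m f) (least_period (skeleton m f))"
  unfolding least_period_def using is_period_skeleton[OF m] by (rule LeastI)

lemma least_period_skeleton_dvd:
  assumes "is_period (skeleton m f) p"
  shows "least_period (skeleton m f) dvd p"
  using is_period_least_period _ assms
  by (rule least_period_dvd) (simp add: least_period_def Least_le)

lemma Per_least_period: "Per (least_period (skeleton m f)) f = Per m f"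
  by (intro equalityI Per_subset_if_is_period_skeleton is_period_least_period
      Per_mono least_period_skeleton_dvd is_period_skeleton m)

text \<open>Passing from \<open>m\<close> to the least period leaves \<open>Per\<close>, hence the
  whole skeleton, unchanged; the new modulus is therefore the least period of its own
  skeleton.\<close>

lemma essential_period_least_period: "essential_period f (least_period (skeleton m f))"
proof -
  have "skeleton (least_period (skeleton m f)) f = skeleton m f"
    using Per_least_period by (auto simp: skeleton_def fun_eq_iff)
  then show ?thesis
    unfolding essential_period_def using is_period_least_period
    by (simp add: least_period_def Least_le)
qed

end

lemma least_period_skeleton_dvd_mono:
  assumes "m dvd m'" "m' \<ge> 1"
  shows "least_period (skeleton m f) dvd least_period (skeleton m' f)"
proof -
  have "m \<ge> 1" using assms by (cases m) auto
  moreover have "least_period (skeleton m' f) \<ge> 1"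
    using is_period_least_period[OF assms(2)] unfolding is_period_def by blast
  moreover have "Per m f \<subseteq> Per (least_period (skeleton m' f)) f"
    unfolding Per_least_period[OF assms(2)] using assms(1) by (rule Per_mono)
  ultimately show ?thesis
    using least_period_skeleton_dvd is_period_skeleton_if_Per_subset by metis
qed

text \<open>Factorials form a divisibility chain in which every \<open>m \<ge> 1\<close> divides a
  member, so their \<open>Per\<close> sets exhaust the positive integers. Least periods keep these
  sets and the divisibilities.\<close>

lemma period_structure_fact:
  assumes "toeplitz f"
  shows "period_structure f (\<lambda>k. least_period (skeleton (fact k) f))"
proof -
  have 1: "fact k \<ge> (1::nat)" for k by simp
  have "\<exists>k. n \<in> Per (fact k) f" if "n \<ge> 1" for n
  proof -
    have "n \<in> (\<Union>m\<in>{m. m \<ge> 1}. Per m f)"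
      using assms that unfolding toeplitz_def by (metis mem_Collect_eq)
    then obtain m where "m \<ge> 1" "n \<in> Per m f" by blast
    then show ?thesis using Per_mono[of m "fact m" f] by (auto simp: dvd_fact)
  qed
  then have "{n. n \<ge> 1} = (\<Union>k. Per (fact k) f)" by (auto simp: Per_def)
  then show ?thesis
    unfolding period_structure_def Per_least_period[OF 1]
    by (intro conjI allI essential_period_least_period least_period_skeleton_dvd_mono 1)
      (simp_all add: fact_dvd)
qed

section \<open>Densities of periodic sets\<close>

lemma card_periodic:
  fixes A :: "nat set"
  assumes "\<And>n. n \<ge> 1 \<Longrightarrow> n + p \<in> A \<longleftrightarrow> n \<in> A"
  shows "card {j \<in> {1..c * p}. j \<in> A} = c * card {j \<in> {1..p}. j \<in> A}"
proof (induction c)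
  case (Suc c)
  have shift: "n + k * p \<in> A \<longleftrightarrow> n \<in> A" if "n \<ge> 1" for n k
  proof (induction k)
    case (Suc k)
    then show ?case using assms[of "n + k * p"] that by (simp add: algebra_simps)
  qed simp
  have "{j \<in> {1..Suc c * p}. j \<in> A} =
        {j \<in> {1..c * p}. j \<in> A} \<union> (\<lambda>j. j + c * p) ` {j \<in> {1..p}. j \<in> A}" (is "?L = ?B \<union> ?C")
  proof (rule set_eqI)
    fix j
    show "j \<in> ?L \<longleftrightarrow> j \<in> ?B \<union> ?C"
    proof (cases "j \<le> c * p")
      case True
      then show ?thesis by auto
    next
      case False
      then obtain i where "j = i + c * p" "i \<ge> 1"
        by (metis add.commute less_imp_add_positive not_le Suc_leI One_nat_def)
      then show ?thesis using shift[of i c] by auto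
    qed
  qed
  moreover have "?B \<inter> ?C = {}" by auto
  moreover have "card ?C = card {j \<in> {1..p}. j \<in> A}"
    by (rule card_image) (auto simp: inj_on_def)
  ultimately show ?case using Suc by (simp add: card_Un_disjoint)
qed simp

text \<open>The proportion of a periodic set is the same over one period and over a multiple of it,
  so \<open>fact k\<close> may replace the essential period that divides it.\<close>

lemma regular_toeplitzI:
  assumes "toeplitz f"
    and lim: "(\<lambda>k. real (card {j \<in> {1..fact k}. j \<in> Per (fact k) f}) / real (fact k)) \<longlonglongrightarrow> 1"
  shows "regular_toeplitz f"
proof -
  define m where "m k = least_period (skeleton (fact k) f)" for k
  have "real (card {j \<in> {1..m k}. j \<in> Per (m k) f}) / real (m k) =
        real (card {j \<in> {1..fact k}. j \<in> Per (fact k) f}) / real (fact k)" for k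
  proof -
    have 1: "fact k \<ge> (1::nat)" by simp
    have Per: "Per (m k) f = Per (fact k) f"
      unfolding m_def by (rule Per_least_period[OF 1])
    have "m k dvd fact k"
      unfolding m_def by (intro least_period_skeleton_dvd is_period_skeleton 1)
    then obtain c where c: "fact k = c * m k" by (metis dvd_def mult.commute)
    have "n + m k \<in> Per (m k) f \<longleftrightarrow> n \<in> Per (m k) f" if "n \<ge> 1" for n
      using Per_cong(1)[of n "m k" f "n + m k"] Per_cong(1)[of "n + m k" "m k" f n] that
      by (auto simp: cong_def)
    from card_periodic[of "m k" "Per (m k) f", OF this, of c]
    have "card {j \<in> {1..fact k}. j \<in> Per (fact k) f} = c * card {j \<in> {1..m k}. j \<in> Per (m k) f}"
      by (simp add: c Per)
    moreover have "real (fact k) = real c * real (m k)" unfolding c by simp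
    moreover have "c \<noteq> 0" using c fact_nonzero[of k, where 'a=nat] by (intro notI) simp
    ultimately show ?thesis by simp
  qed
  then have "(\<lambda>k. real (card {j \<in> {1..m k}. j \<in> Per (m k) f}) / real (m k)) \<longlonglongrightarrow> 1"
    using lim by simp
  then show ?thesis
    using assms(1) period_structure_fact[OF assms(1)] unfolding regular_toeplitz_def m_def by blast
qed

section \<open>From Toeplitz to a character\<close>

lemma multiplicative_fun_one:
  assumes "multiplicative_fun f" "n \<ge> 1" "f n \<noteq> 0"
  shows "f 1 = 1"
  using assms unfolding multiplicative_fun_def
  by (metis coprime_1_right le_refl mult.right_neutral mult_cancel_left1)

context
  fixes f :: "nat \<Rightarrow> complex" and m :: nat
  assumes mult: "multiplicative_fun f" and f1: "f 1 = 1"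
    and m: "m \<ge> 1" and per: "1 \<in> Per m f"
begin

text \<open>With \<open>d\<close> inverse to \<open>a\<close> and \<open>b\<close> modulo
  \<open>m\<close> and coprime to both,
  \<open>f a * f d = f (a * d) = 1 = f (b * d) = f b * f d\<close>.\<close>

lemma coprime_cong_eq:
  assumes "a \<ge> 1" "b \<ge> 1" "coprime a m" "[a = b] (mod m)"
  shows "f a = f b" "f a \<noteq> 0"
proof -
  have b: "coprime b m" using assms cong_imp_coprime by blast
  obtain a' where a': "[a * a' = 1] (mod m)"
    using assms(3) cong_solve_coprime_nat by auto
  obtain c where c: "[c = a'] (mod m)" "[c = 1] (mod a * b)"
    using binary_chinese_remainder_nat[of m "a * b" a' 1] assms(3) b
    by (metis coprime_commute coprime_mult_left_iff)
  \<comment> \<open>The witness \<open>c\<close> may be 0; adding a common multiple of both moduli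
    makes it positive.\<close>
  define d where "d = c + m * (a * b)"
  have d: "d \<ge> 1" "[d = a'] (mod m)" "[d = 1] (mod a * b)"
    using assms m c unfolding d_def by (auto simp: cong_def Suc_le_eq)
  have "coprime d (a * b)" using cong_imp_coprime[OF cong_sym[OF d(3)]] by simp
  then have cop: "coprime a d" "coprime b d" by (simp_all add: coprime_commute)
  have ad: "[a * d = 1] (mod m)"
    using cong_trans[OF cong_scalar_left[OF d(2), of a] a'] .
  have bd: "[b * d = 1] (mod m)"
    using cong_trans[OF cong_scalar_right[OF cong_sym[OF assms(4)], of d] ad] .
  have "f (a * d) = 1" "f (b * d) = 1"
    using Per_cong(2)[OF per _ ad] Per_cong(2)[OF per _ bd] assms d f1 by auto
  moreover have "f (a * d) = f a * f d" "f (b * d) = f b * f d"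
    using mult cop assms d unfolding multiplicative_fun_def by auto
  ultimately have "f a * f d = 1" "f b * f d = 1" by simp_all
  then show "f a \<noteq> 0" "f a = f b"
    by (auto simp: field_simps) (metis mult_cancel_right mult_zero_right zero_neq_one)
qed

text \<open>Replace \<open>b\<close> by some \<open>d\<close> in its class modulo \<open>m\<close>
  that is coprime to \<open>a\<close>; by the previous lemma neither \<open>f b\<close> nor
  \<open>f (a * b)\<close> changes.\<close>

lemma coprime_mult_eq:
  assumes "a \<ge> 1" "b \<ge> 1" "coprime a m" "coprime b m"
  shows "f (a * b) = f a * f b"
proof -
  obtain c where c: "[c = b] (mod m)" "[c = 1] (mod a)"
    using binary_chinese_remainder_nat[of m a b 1] assms(3) by (metis coprime_commute)
  define d where "d = c + m * a"
  have d: "d \<ge> 1" "[d = b] (mod m)" "[d = 1] (mod a)"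
    using assms m c unfolding d_def by (auto simp: cong_def Suc_le_eq)
  have "coprime a d"
    using cong_imp_coprime[OF cong_sym[OF d(3)]] by (simp add: coprime_commute)
  then have "f (a * d) = f a * f d"
    using mult assms d unfolding multiplicative_fun_def by auto
  moreover have "f b = f d"
    using coprime_cong_eq(1)[of b d] assms d cong_sym by blast
  moreover have "f (a * b) = f (a * d)"
    by (rule coprime_cong_eq(1)) (use assms d in \<open>auto intro: cong_scalar_left cong_sym\<close>)
  ultimately show ?thesis by simp
qed

text \<open>The shift by \<open>m\<close> avoids the value of \<open>f\<close> at 0, which is arbitrary but matters for \<open>m = 1\<close>.\<close>

lemma dirichlet_character_of_Per:
  defines "\<chi> \<equiv> \<lambda>n. if coprime n m then f (n + m) else 0"
  shows "dirichlet_character m \<chi>" "n \<ge> 1 \<Longrightarrow> coprime n m \<Longrightarrow> f n = \<chi> n"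
proof -
  show "f n = \<chi> n" if "n \<ge> 1" "coprime n m" for n
    unfolding \<chi>_def using coprime_cong_eq(1)[of n "n + m"] that by (simp add: cong_def)
  have "\<chi> (n + m) = \<chi> n" for n
    unfolding \<chi>_def using coprime_cong_eq(1)[of "n + m + m" "n + m"] m
    by (auto simp: cong_def coprime_iff_gcd_eq_1)
  moreover have "\<chi> (a * b) = \<chi> a * \<chi> b" for a b
  proof (cases "coprime a m \<and> coprime b m")
    case True
    then have "f ((a + m) * (b + m)) = f (a + m) * f (b + m)"
      using coprime_mult_eq[of "a + m" "b + m"] m by (auto simp: coprime_iff_gcd_eq_1)
    moreover have "f (a * b + m) = f ((a + m) * (b + m))"
    proof (rule coprime_cong_eq(1))
      have "(a + m) * (b + m) = a * b + m + (a + b + m - 1) * m"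
        using m by (cases m) (auto simp: algebra_simps)
      then show "[a * b + m = (a + m) * (b + m)] (mod m)" by (simp add: cong_def)
      have "coprime (a * b) m" using True by simp
      then show "coprime (a * b + m) m" by (simp add: coprime_iff_gcd_eq_1)
    qed (use m in auto)
    ultimately show ?thesis unfolding \<chi>_def using True by simp
  next
    case False
    then show ?thesis unfolding \<chi>_def by auto
  qed
  moreover have "\<chi> n \<noteq> 0 \<longleftrightarrow> coprime n m" for n
    unfolding \<chi>_def using coprime_cong_eq(2)[of "n + m" "n + m"] m
    by (auto simp: coprime_iff_gcd_eq_1)
  ultimately show "dirichlet_character m \<chi>" unfolding dirichlet_character_def using m by blast
qed

end

lemma toeplitz_imp_character:
  assumes mult: "multiplicative_fun f" and "n \<ge> 1" "f n \<noteq> 0" and "toeplitz f"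
  obtains q \<chi> F where "dirichlet_character q \<chi>" "finite F" "\<forall>p\<in>F. prime p"
    "\<forall>n\<ge>1. (\<forall>p\<in>F. coprime n p) \<longrightarrow> f n = \<chi> n"
proof -
  have f1: "f 1 = 1" using assms by (blast intro: multiplicative_fun_one)
  obtain m where m: "m \<ge> 1" "1 \<in> Per m f" using assms(4) unfolding toeplitz_def by blast
  \<comment> \<open>With all prime divisors of \<open>m\<close> in \<open>F\<close>, a number
    coprime to every member of \<open>F\<close> is coprime to \<open>m\<close>.\<close>
  define F where "F = {p. prime p \<and> p dvd m}"
  have "F \<subseteq> {..m}" unfolding F_def using m by (auto dest: dvd_imp_le)
  then have "finite F" using finite_subset by blast
  moreover have "coprime n m" if "\<forall>p\<in>F. coprime n p" for n
  proof (rule ccontr)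
    assume "\<not> coprime n m"
    then have "gcd n m \<noteq> 1" by (simp add: coprime_iff_gcd_eq_1)
    then obtain p where "prime p" "p dvd gcd n m" using prime_factor_nat by blast
    then show False
      using that unfolding F_def by (auto simp: coprime_absorb_right prime_nat_iff)
  qed
  ultimately show ?thesis
    using dirichlet_character_of_Per[OF mult f1 m] that[of m _ F] unfolding F_def by blast
qed

section \<open>From a character to regularity\<close>

lemma dirichlet_character_cong:
  assumes "dirichlet_character q \<chi>" "[a = b] (mod q)"
  shows "\<chi> a = \<chi> b"
proof -
  have "\<chi> (n + k * q) = \<chi> n" for n k
  proof (induction k)
    case (Suc k)
    have "\<chi> (n + k * q + q) = \<chi> (n + k * q)"
      using assms unfolding dirichlet_character_def by blast
    then show ?case using Suc by (simp add: algebra_simps)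
  qed simp
  then have "\<chi> n = \<chi> (n mod q)" for n
    by (metis add.commute div_mult_mod_eq)
  then show ?thesis using assms(2) unfolding cong_def by metis
qed

text \<open>If \<open>p \<in> F\<close> divided the quotient, then \<open>p ^ j dvd n\<close> with
  \<open>j < e\<close> would put \<open>p ^ j\<close> into the gcd and yield
  \<open>p ^ Suc j dvd n\<close>, climbing up to the excluded \<open>p ^ e\<close>.\<close>

lemma coprime_div_gcd_prod_power:
  fixes F :: "nat set"
  assumes F: "finite F" "\<forall>p\<in>F. prime p" and n: "n \<ge> 1" and e: "\<forall>p\<in>F. \<not> p ^ e dvd n"
  shows "coprime (n div gcd n (\<Prod>F ^ e)) (\<Prod>F)"
proof (rule prod_coprime_right)
  fix p assume p: "p \<in> F"
  define A where "A = gcd n (\<Prod>F ^ e)"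
  have "p dvd \<Prod>F" using p F by (simp add: dvd_prodI[of F p "\<lambda>x. x", simplified])
  have "\<not> p dvd n div A"
  proof
    assume dvd: "p dvd n div A"
    have "p ^ j dvd n" if "j \<le> e" for j using that
    proof (induction j)
      case (Suc j)
      then have "p ^ j dvd n" by simp
      moreover have "p ^ j dvd \<Prod>F ^ e"
        using \<open>p dvd \<Prod>F\<close> Suc.prems by (meson Suc_leD dvd_power_le)
      ultimately have "p ^ j dvd A" unfolding A_def by simp
      with dvd have "p * p ^ j dvd n div A * A" by (rule mult_dvd_mono)
      then show ?case unfolding A_def by simp
    qed simp
    then show False using e p by blast
  qed
  then show "coprime (n div gcd n (\<Prod>F ^ e)) p"
    using F p unfolding A_def by (metis coprime_commute prime_imp_coprime)
qed

context
  fixes f :: "nat \<Rightarrow> complex" and q :: nat and \<chi> :: "nat \<Rightarrow> complex" and F :: "nat set"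
  assumes mult: "multiplicative_fun f" and chi: "dirichlet_character q \<chi>"
    and F: "finite F" "\<forall>p\<in>F. prime p"
    and f_eq: "\<forall>n\<ge>1. (\<forall>p\<in>F. coprime n p) \<longrightarrow> f n = \<chi> n"
begin

lemma q_prod_pos: "q * \<Prod>F ^ e \<ge> 1"
proof -
  have "\<forall>p\<in>F. 0 < p" using F(2) prime_gt_0_nat by blast
  then have "\<Prod>F > 0" by (simp add: prod_pos)
  then show ?thesis using chi unfolding dirichlet_character_def by (simp add: Suc_le_eq)
qed

lemma f_factor:
  assumes n: "n \<ge> 1" and e: "\<forall>p\<in>F. \<not> p ^ e dvd n"
  shows "f n = f (gcd n (\<Prod>F ^ e)) * \<chi> (n div gcd n (\<Prod>F ^ e))"
proof -
  define A B where "A = gcd n (\<Prod>F ^ e)" and "B = n div A"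
  have AB: "n = A * B" unfolding A_def B_def by simp
  then have pos: "A \<ge> 1" "B \<ge> 1" using n by (cases A; cases B; simp)+
  have cop: "coprime B (\<Prod>F)"
    unfolding B_def A_def using coprime_div_gcd_prod_power[OF F n e] .
  then have "coprime B (\<Prod>F ^ e)" by simp
  then have "coprime A B"
    unfolding A_def by (metis coprime_commute coprime_divisors dvd_refl gcd_dvd2)
  then have "f n = f A * f B" using mult pos AB unfolding multiplicative_fun_def by metis
  moreover have "f B = \<chi> B"
  proof -
    have "coprime B p" if "p \<in> F" for p
      using cop dvd_prodI[of F p "\<lambda>x. x"] F that by (metis coprime_divisors dvd_refl)
    then show ?thesis using f_eq pos by blast
  qed
  ultimately show ?thesis unfolding A_def B_def by simp
qed

text \<open>Both factors in \<open>f_factor\<close> depend only on the class of \<open>n\<close>: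
  the gcd on its class modulo \<open>\<Prod>F ^ e\<close>, and the cofactor modulo \<open>q\<close>
  on its class modulo \<open>q * \<Prod>F ^ e\<close>.\<close>

lemma in_Per_prod_power:
  assumes n: "n \<ge> 1" and e: "\<forall>p\<in>F. \<not> p ^ e dvd n"
  shows "n \<in> Per (q * \<Prod>F ^ e) f"
proof -
  have "f n = f n'" if n': "n' \<ge> 1" "[n' = n] (mod q * \<Prod>F ^ e)" for n'
  proof -
    have cong: "[n' = n] (mod \<Prod>F ^ e)"
      using n'(2) by (rule cong_dvd_modulus_nat) simp
    then have gcd: "gcd n' (\<Prod>F ^ e) = gcd n (\<Prod>F ^ e)" by (rule cong_gcd_eq)
    define A where "A = gcd n (\<Prod>F ^ e)"
    have A: "A dvd n" "A dvd n'" "A dvd \<Prod>F ^ e"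
      unfolding A_def by (simp, metis gcd gcd_dvd1, simp)
    have "A \<noteq> 0" unfolding A_def using n by simp
    have e': "\<forall>p\<in>F. \<not> p ^ e dvd n'"
    proof
      fix p assume p: "p \<in> F"
      then have "p ^ e dvd \<Prod>F ^ e"
        using dvd_prodI[of F p "\<lambda>x. x"] F by (simp add: dvd_power_same)
      then have "[n' = n] (mod p ^ e)" using cong cong_dvd_modulus_nat by blast
      then show "\<not> p ^ e dvd n'" using e p cong_dvd_iff by blast
    qed
    \<comment> \<open>A congruence modulo \<open>A * q\<close> between multiples of \<open>A\<close>
      can be divided by \<open>A\<close>, leaving the modulus \<open>q\<close> of the
      character.\<close>
    have "A * q dvd q * \<Prod>F ^ e" using A(3) by (simp add: mult.commute mult_dvd_mono)
    then have "[A * (n' div A) = A * (n div A)] (mod A * q)"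
      using n'(2) A by (simp add: cong_dvd_modulus_nat)
    then have "[n' div A = n div A] (mod q)"
      using \<open>A \<noteq> 0\<close> by (simp add: cong_def mult_mod_right[symmetric])
    then have "\<chi> (n' div A) = \<chi> (n div A)" by (rule dirichlet_character_cong[OF chi])
    then show ?thesis
      using f_factor[OF n e] f_factor[OF n'(1) e'] unfolding gcd A_def by simp
  qed
  then show ?thesis unfolding Per_def using n by blast
qed

lemma toeplitz_of_character: "toeplitz f"
proof -
  \<comment> \<open>The exponent \<open>n\<close> is large enough because
    \<open>p ^ n > n\<close>.\<close>
  have "n \<in> Per (q * \<Prod>F ^ n) f" if "n \<ge> 1" for n
  proof (rule in_Per_prod_power[OF that], intro ballI notI)
    fix p assume p: "p \<in> F" "p ^ n dvd n"
    then have "p ^ n \<le> n" using that by (auto dest: dvd_imp_le)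
    moreover have "prime p" using F p by blast
    then have "n < p ^ n" using power_gt_expt[of p n] prime_gt_1_nat[of p] by simp
    ultimately show False by simp
  qed
  then have "{n. n \<ge> 1} \<subseteq> (\<Union>m\<in>{m. m \<ge> 1}. Per m f)" using q_prod_pos by blast
  moreover have "(\<Union>m\<in>{m. m \<ge> 1}. Per m f) \<subseteq> {n. n \<ge> 1}" unfolding Per_def by blast
  ultimately show ?thesis unfolding toeplitz_def by (rule equalityI)
qed

text \<open>Union bound: a position outside \<open>Per M f\<close> is divisible by
  \<open>p ^ e\<close> for some \<open>p \<in> F\<close>, and up to \<open>M\<close> there are at
  most \<open>M / p ^ e \<le> M / 2 ^ e\<close> such multiples for each \<open>p\<close>.\<close>

lemma card_Per_ge:
  assumes M: "q * \<Prod>F ^ e dvd M" "M \<ge> 1"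
  shows "real (card {j \<in> {1..M}. j \<in> Per M f}) / real M \<ge> 1 - real (card F) / 2 ^ e"
proof -
  let ?G = "{j \<in> {1..M}. j \<in> Per M f}"
  let ?H = "\<lambda>p. {j \<in> {1..M}. p ^ e dvd j}"
  have "j \<in> ?G \<union> (\<Union>p\<in>F. ?H p)" if "j \<in> {1..M}" for j
    using in_Per_prod_power[of j e] Per_mono[OF M(1), of f] that by auto
  then have "{1..M} \<subseteq> ?G \<union> (\<Union>p\<in>F. ?H p)" by blast
  then have "M \<le> card (?G \<union> (\<Union>p\<in>F. ?H p))"
    using F(1) card_mono[of "?G \<union> (\<Union>p\<in>F. ?H p)" "{1..M}"] by simp
  also have "\<dots> \<le> card ?G + card (\<Union>p\<in>F. ?H p)" by (rule card_Un_le)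
  also have "\<dots> \<le> card ?G + (\<Sum>p\<in>F. card (?H p))"
    using card_UN_le[OF F(1)] by simp
  finally have "real M \<le> real (card ?G + (\<Sum>p\<in>F. card (?H p)))"
    by (rule of_nat_mono)
  then have "real M \<le> real (card ?G) + (\<Sum>p\<in>F. real (card (?H p)))" by simp
  also have "(\<Sum>p\<in>F. real (card (?H p))) \<le> (\<Sum>p\<in>F. real M / 2 ^ e)"
  proof (rule sum_mono)
    fix p assume p: "p \<in> F"
    then have p2: "2 \<le> p" using F prime_ge_2_nat by blast
    then have "p ^ e > 0" by simp
    have "?H p \<subseteq> (\<lambda>i. p ^ e * i) ` {1..M div p ^ e}"
    proof
      fix j assume j: "j \<in> ?H p"
      then obtain i where i: "j = p ^ e * i" by (auto elim: dvdE)
      then have "i \<le> M div p ^ e"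
        using j \<open>p ^ e > 0\<close> by (simp add: less_eq_div_iff_mult_less_eq mult.commute)
      moreover have "i \<ge> 1" using i j by (cases i) auto
      ultimately show "j \<in> (\<lambda>i. p ^ e * i) ` {1..M div p ^ e}" using i by auto
    qed
    then have "card (?H p) \<le> card {1..M div p ^ e}" by (rule surj_card_le[rotated]) simp
    then have "real (card (?H p)) \<le> real (M div p ^ e)" by simp
    also have "\<dots> \<le> real M / real (p ^ e)" by (rule of_nat_div_le_of_nat)
    also have "\<dots> \<le> real M / 2 ^ e"
      using p2 by (intro divide_left_mono) (auto intro: power_mono)
    finally show "real (card (?H p)) \<le> real M / 2 ^ e" .
  qed
  finally have "real M \<le> real (card ?G) + real (card F) * (real M / 2 ^ e)" by simp
  then show ?thesis using M(2) by (simp add: field_simps)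
qed

lemma regular_of_character: "regular_toeplitz f"
proof (rule regular_toeplitzI[OF toeplitz_of_character])
  let ?d = "\<lambda>k. real (card {j \<in> {1..fact k}. j \<in> Per (fact k) f}) / real (fact k)"
  have le1: "?d k \<le> 1" for k
  proof -
    have "card {j \<in> {1..fact k}. j \<in> Per (fact k) f} \<le> card {1..fact k :: nat}"
      by (rule card_mono) auto
    also have "\<dots> = fact k" by simp
    finally have "real (card {j \<in> {1..fact k}. j \<in> Per (fact k) f}) \<le> real (fact k)"
      by (rule of_nat_mono)
    then show ?thesis by simp
  qed
  show "?d \<longlonglongrightarrow> 1"
  proof (rule LIMSEQ_I)
    fix r :: real assume "r > 0"
    have "(\<lambda>e. real (card F) * (1/2) ^ e) \<longlonglongrightarrow> real (card F) * 0"
      by (intro tendsto_mult tendsto_const LIMSEQ_power_zero) simp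
    then have "\<forall>\<^sub>F e in sequentially. real (card F) * (1/2) ^ e < r"
      using order_tendstoD(2) \<open>r > 0\<close> by fastforce
    then obtain e where e: "real (card F) * (1/2) ^ e < r"
      by (auto simp: eventually_sequentially)
    \<comment> \<open>Once \<open>k\<close> reaches \<open>q * \<Prod>F ^ e\<close>, this modulus
      divides \<open>fact k\<close>, so the bound for the fixed \<open>e\<close> applies.\<close>
    have "norm (?d k - 1) < r" if k: "k \<ge> q * \<Prod>F ^ e" for k
    proof -
      have "q * \<Prod>F ^ e dvd fact k" by (rule dvd_fact[OF q_prod_pos k])
      from card_Per_ge[OF this] have "?d k \<ge> 1 - real (card F) / 2 ^ e" by simp
      moreover have "real (card F) / 2 ^ e < r" using e by (simp add: power_divide)
      ultimately have "?d k > 1 - r" by linarith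
      then show ?thesis using le1[of k] \<open>r > 0\<close> by (simp only: real_norm_def abs_less_iff) linarith
    qed
    then show "\<exists>k0. \<forall>k\<ge>k0. norm (?d k - 1) < r" by blast
  qed
qed

end

text \<open>This case is separate since no character can agree with the zero sequence at 1; every
  position is periodic for every modulus.\<close>

lemma regular_toeplitz_zero:
  assumes "\<forall>n\<ge>1. f n = (0::complex)"
  shows "regular_toeplitz f"
proof -
  have Per: "Per m f = {n. n \<ge> 1}" for m using assms unfolding Per_def by fastforce
  show ?thesis
  proof (rule regular_toeplitzI)
    show "toeplitz f" unfolding toeplitz_def Per by auto
    have "{j \<in> {1..fact k}. j \<in> Per (fact k) f} = {1..fact k}" for k unfolding Per by auto
    then show "(\<lambda>k. real (card {j \<in> {1..fact k}. j \<in> Per (fact k) f}) / real (fact k)) \<longlonglongrightarrow> 1"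
      by simp
  qed
qed

theorem theorem0p1:
  fixes f :: "nat \<Rightarrow> complex"
  assumes "multiplicative_fun f"
  shows "((\<exists>n\<ge>1. f n \<noteq> 0) \<longrightarrow>
           (toeplitz f \<longleftrightarrow>
             (\<exists>q \<chi> F. dirichlet_character q \<chi> \<and> finite F \<and> (\<forall>p\<in>F. prime p) \<and>
                (\<forall>n\<ge>1. (\<forall>p\<in>F. coprime n p) \<longrightarrow> f n = \<chi> n))))
         \<and> (toeplitz f \<longrightarrow> regular_toeplitz f)"
proof (cases "\<exists>n\<ge>1. f n \<noteq> 0")
  case True
  then obtain n where n: "n \<ge> 1" "f n \<noteq> 0" by blast
  \<comment> \<open>Regularity of a Toeplitz \<open>f\<close> passes through the character that the
    first implication supplies.\<close>
  show ?thesis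
    using toeplitz_imp_character[OF assms n] toeplitz_of_character[OF assms]
      regular_of_character[OF assms] by metis
next
  case False
  then show ?thesis using regular_toeplitz_zero by blast
qed

end
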